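(* We have $$\tilde{\mathfrak{S}}(132,312)^{\mathsf{des},\mathsf{iar},\mathsf{comp}}(t,r,p)=\frac{1}{1-rpz}+\frac{(1-z)tz}{(1-rz)(1-pz)(1-z-tz)},$$ $$\tilde{\mathfrak{S}}(132,321)^{\mathsf{des},\mathsf{iar},\mathsf{comp}}(t,r,p)=\frac{1}{1-rpz}+\frac{tz}{(1-rz)(1-pz)(1-z)}.$$
   Context: $\mathfrak{S}_n$ is the set of permutations $\pi=\pi(1)\cdots\pi(n)$ of $[n]=\{1,\dots,n\}$. A permutation $\pi\in\mathfrak{S}_n$ contains the pattern $\sigma\in\mathfrak{S}_k$ if there are $j_1<\cdots<j_k$ such that $\pi(j_a)<\pi(j_b)$ if and only if $\sigma(a)<\sigma(b)$ for all $1\le a<b\le k$; otherwise it avoids $\sigma$. For a set $P$ of patterns, $\mathfrak{S}_n(P)$ is the set of $\pi\in\mathfrak{S}_n$ avoiding every pattern in $P$. For $\pi\in\mathfrak{S}_n$: $\mathrm{DES}(\pi)=\{i\in[n-1]:\pi(i)>\pi(i+1)\}$, $\mathsf{des}(\pi)=|\mathrm{DES}(\pi)|$, $\mathsf{iar}(\pi)=\min(\mathrm{DES}(\pi)\cup\{n\})$, $\mathsf{comp}(\pi)=|\{i\in[n]:\pi(j)\le i\text{ for all }j\le i\}|$. Define the formal power series in $z$ $$\mathfrak{S}(P)^{\mathsf{des},\mathsf{iar},\mathsf{comp}}(t,r,p;z)=\sum_{n\ge0}z^n\sum_{\pi\in\mathfrak{S}_n(P)}t^{\mathsf{des}(\pi)}r^{\mathsf{iar}(\pi)}p^{\mathsf{comp}(\pi)},$$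 where the empty permutation ($n=0$) contributes $1$, and $\tilde{\mathfrak{S}}(P)^{\mathsf{des},\mathsf{iar},\mathsf{comp}}(t,r,p)=\big(\mathfrak{S}(P)^{\mathsf{des},\mathsf{iar},\mathsf{comp}}(t,r,p;z)-1\big)/(rpz)$. *)

theory Defs
  imports
    "HOL-Combinatorics.Multiset_Permutations"
    "HOL-Computational_Algebra.Computational_Algebra"
begin

text \<open>
  A permutation of \<open>{1..n}\<close> is its one-line word, i.e. an element of the library's
  \<open>permutations_of_set {1..n}\<close>. Positions and values are counted from 1, list indices from 0.
\<close>

definition entry :: "nat list \<Rightarrow> nat \<Rightarrow> nat" where
  "entry \<pi> i = \<pi> ! (i - 1)"

definition contains_pattern :: "nat list \<Rightarrow> nat list \<Rightarrow> bool" where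
  "contains_pattern \<pi> \<sigma> \<longleftrightarrow>
     (\<exists>j. strict_mono_on {1..length \<sigma>} j \<and> j ` {1..length \<sigma>} \<subseteq> {1..length \<pi>} \<and>
        (\<forall>a b. 1 \<le> a \<and> a < b \<and> b \<le> length \<sigma> \<longrightarrow>
           (entry \<pi> (j a) < entry \<pi> (j b) \<longleftrightarrow> entry \<sigma> a < entry \<sigma> b)))"

definition avoiders :: "nat \<Rightarrow> nat list set \<Rightarrow> nat list set" where
  "avoiders n P = {\<pi> \<in> permutations_of_set {1..n}. \<forall>\<sigma>\<in>P. \<not> contains_pattern \<pi> \<sigma>}"

definition DES :: "nat list \<Rightarrow> nat set" where
  "DES \<pi> = {i. 1 \<le> i \<and> i < length \<pi> \<and> entry \<pi> i > entry \<pi> (i + 1)}"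

definition des :: "nat list \<Rightarrow> nat" where
  "des \<pi> = card (DES \<pi>)"

definition iar :: "nat list \<Rightarrow> nat" where
  "iar \<pi> = Min (DES \<pi> \<union> {length \<pi>})"

definition num_comp :: "nat list \<Rightarrow> nat" where
  "num_comp \<pi> = card {i \<in> {1..length \<pi>}. \<forall>j\<in>{1..i}. entry \<pi> j \<le> i}"

text \<open>The variable \<open>z\<close> is \<^const>\<open>fps_X\<close>; for \<open>n = 0\<close> the only summand is the empty word, with weight 1.\<close>

definition des_iar_comp_gf ::
  "nat list set \<Rightarrow> 'a \<Rightarrow> 'a \<Rightarrow> 'a \<Rightarrow> 'a::comm_ring_1 fps" where
  "des_iar_comp_gf P t r p =
     Abs_fps (\<lambda>n. \<Sum>\<pi>\<in>avoiders n P. t ^ des \<pi> * r ^ iar \<pi> * p ^ num_comp \<pi>)"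

definition des_iar_comp_gf_tilde ::
  "nat list set \<Rightarrow> 'a \<Rightarrow> 'a \<Rightarrow> 'a \<Rightarrow> 'a::field fps" where
  "des_iar_comp_gf_tilde P t r p =
     (des_iar_comp_gf P t r p - 1) / (fps_const (r * p) * fps_X)"

text \<open>
  The indeterminates \<open>t\<close>, \<open>r\<close>, \<open>p\<close> live in the fraction field of \<open>\<int>[t][r][p]\<close>; with these
  coefficients, division of power series by \<open>r p z\<close> and by \<open>1 - r p z\<close> etc. is available as \<open>/\<close>.
\<close>

type_synonym coeff_field = "int poly poly poly fract"

definition var_t :: coeff_field where
  "var_t = to_fract [:[:[:0, 1:]:]:]"

definition var_r :: coeff_field where
  "var_r = to_fract [:[:0, 1:]:]"

definition var_p :: coeff_field where
  "var_p = to_fract [:0, 1:]"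

end

theory Submission
  imports Defs
begin

text \<open>
  Both pattern sets contain 132, and no pattern in them ends with its largest letter. Appending a
  new maximum to an avoider therefore gives an avoider again (\<open>avoiders_snoc_max\<close>). The increasing
  words contribute \<open>1 / (1 - r p z)\<close>. Let \<open>D\<close> be the generating function of the avoiders that have
  a descent. Such a word of length \<open>n + 1\<close> either arises from one of length \<open>n\<close> by appending
  \<open>n + 1\<close>, or is an arbitrary avoider whose last letter is not \<open>n + 1\<close>. In the first case \<^const>\<open>des\<close> and
  \<^const>\<open>iar\<close> stay the same and \<^const>\<open>num_comp\<close> grows by one. In the second case \<^const>\<open>num_comp\<close> is 1, because
  an earlier component boundary would create a 132 (\<open>num_comp_132_avoider\<close>). With \<open>L\<close> denoting the generating
  function in \<open>t\<close> and \<open>r\<close> of these low-ended words, shifted by one in length, this says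
  \<open>D = p z (D + L)\<close> (\<open>descending_gf_eq\<close>). Everything thus comes down to computing \<open>L\<close>.

  For 132 and 312, no letter lies strictly between two earlier ones, so each letter is a new maximum
  or a new minimum of its prefix. The low-ended words arise from arbitrary nonempty avoiders by
  appending a new minimum. This adds a descent and keeps \<^const>\<open>iar\<close>. So \<open>L\<close> is \<open>t\<close> times the
  generating function at \<open>p = 1\<close> without the empty word, and this relation together with the previous
  one is a linear system for \<open>L\<close> (\<open>low_ended_gf_132_312\<close>).

  For 132 and 321, the low-ended words of length \<open>n + 1\<close> are the words
  \<open>m+1, \<dots>, n+1, 1, \<dots>, m\<close> with \<open>1 \<le> m \<le> n\<close> (\<open>low_ended_132_321\<close>). They have a single descent, at
  position \<open>n + 1 - m\<close>, so the coefficient of \<open>z\<^sup>n\<close> in \<open>L\<close> is \<open>t (r + \<dots> + r\<^sup>n)\<close>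
  (\<open>low_ended_gf_132_321\<close>).
\<close>

section \<open>Pattern containment\<close>

lemma contains_pattern_3:
  "contains_pattern \<pi> [a, b, c] \<longleftrightarrow>
     (\<exists>i j k. i < j \<and> j < k \<and> k < length \<pi> \<and> (\<pi> ! i < \<pi> ! j \<longleftrightarrow> a < b) \<and>
        (\<pi> ! i < \<pi> ! k \<longleftrightarrow> a < c) \<and> (\<pi> ! j < \<pi> ! k \<longleftrightarrow> b < c))"
  (is "?L \<longleftrightarrow> ?R")
proof
  assume ?L
  then obtain f where f: "strict_mono_on {1..3} f" "f ` {1..3} \<subseteq> {1..length \<pi>}"
    and o: "\<And>x y. 1 \<le> x \<Longrightarrow> x < y \<Longrightarrow> y \<le> 3 \<Longrightarrow>
      (entry \<pi> (f x) < entry \<pi> (f y) \<longleftrightarrow> entry [a,b,c] x < entry [a,b,c] y)"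
    by (auto simp: contains_pattern_def numeral_3_eq_3)
  have m: "f 1 < f 2" "f 2 < f 3"
    using f(1) by (auto simp: strict_mono_on_def)
  have in_range: "f x \<in> {1..length \<pi>}" if "x \<in> {1..3}" for x using f(2) that by blast
  have "f 1 \<in> {1..length \<pi>}" "f 3 \<in> {1..length \<pi>}" by (rule in_range, simp)+
  then have ends: "1 \<le> f 1" "f 3 \<le> length \<pi>" unfolding atLeastAtMost_iff by blast+
  define i j k where "i = f 1 - 1" and "j = f 2 - 1" and "k = f 3 - 1"
  have eqs: "f 1 = Suc i" "f 2 = Suc j" "f 3 = Suc k"
    using m ends unfolding i_def j_def k_def by linarith+
  have "i < j" "j < k" "k < length \<pi>"
    using m ends unfolding eqs by linarith+
  moreover have "(\<pi> ! i < \<pi> ! j \<longleftrightarrow> a < b)" "(\<pi> ! i < \<pi> ! k \<longleftrightarrow> a < c)" "(\<pi> ! j < \<pi> ! k \<longleftrightarrow> b < c)"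
    using o[of 1 2] o[of 1 3] o[of 2 3] unfolding eqs by (simp_all add: entry_def)
  ultimately show ?R by blast
next
  assume ?R
  then obtain i j k where ijk: "i < j" "j < k" "k < length \<pi>" "\<pi> ! i < \<pi> ! j \<longleftrightarrow> a < b"
    "\<pi> ! i < \<pi> ! k \<longleftrightarrow> a < c" "\<pi> ! j < \<pi> ! k \<longleftrightarrow> b < c" by blast
  define f where "f = (\<lambda>m::nat. if m = 1 then Suc i else if m = 2 then Suc j else Suc k)"
  have "strict_mono_on {1..3} f"
    using ijk(1,2) by (auto simp: strict_mono_on_def f_def)
  moreover have "f ` {1..3} \<subseteq> {1..length \<pi>}"
    using ijk(1-3) by (auto simp: f_def)
  moreover have "entry \<pi> (f x) < entry \<pi> (f y) \<longleftrightarrow> entry [a,b,c] x < entry [a,b,c] y"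
    if "1 \<le> x" "x < y" "y \<le> 3" for x y
  proof -
    have "x = 1 \<and> y = 2 \<or> x = 1 \<and> y = 3 \<or> x = 2 \<and> y = 3"
      using that by auto
    with ijk show ?thesis by (auto simp: entry_def f_def)
  qed
  ultimately show ?L
    unfolding contains_pattern_def by (intro exI[of _ f]) (auto simp: numeral_3_eq_3)
qed

lemma entry_append_left: "1 \<le> i \<Longrightarrow> i \<le> length xs \<Longrightarrow> entry (xs @ ys) i = entry xs i"
  by (auto simp: entry_def nth_append)

text \<open>
  The last letter of such a pattern does not exceed some earlier one, so in an occurrence its role
  can never be taken by a final letter that exceeds everything before it.
\<close>

definition ends_below_max :: "nat list \<Rightarrow> bool" where
  "ends_below_max \<sigma> \<longleftrightarrow> (\<exists>a. 1 \<le> a \<and> a < length \<sigma> \<and> \<not> entry \<sigma> a < entry \<sigma> (length \<sigma>))"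

lemma ends_below_max_patterns:
  "ends_below_max [1, 3, 2]" "ends_below_max [3, 1, 2]" "ends_below_max [3, 2, 1]"
proof -
  have "ends_below_max [a, b, c]" if "c \<le> a \<or> c \<le> b" for a b c
    using that unfolding ends_below_max_def
    by (auto simp: entry_def intro: exI[of _ 1] exI[of _ 2])
  then show "ends_below_max [1, 3, 2]" "ends_below_max [3, 1, 2]" "ends_below_max [3, 2, 1]"
    by simp_all
qed

lemma contains_pattern_snoc_max:
  assumes \<sigma>: "ends_below_max \<sigma>" and x: "\<forall>y\<in>set \<pi>. y < x"
  shows "contains_pattern (\<pi> @ [x]) \<sigma> \<longleftrightarrow> contains_pattern \<pi> \<sigma>"
proof
  assume "contains_pattern (\<pi> @ [x]) \<sigma>"
  then obtain f where f: "strict_mono_on {1..length \<sigma>} f"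
    "f ` {1..length \<sigma>} \<subseteq> {1..Suc (length \<pi>)}"
    and o: "\<And>a b. 1 \<le> a \<Longrightarrow> a < b \<Longrightarrow> b \<le> length \<sigma> \<Longrightarrow>
      (entry (\<pi> @ [x]) (f a) < entry (\<pi> @ [x]) (f b) \<longleftrightarrow> entry \<sigma> a < entry \<sigma> b)"
    by (auto simp: contains_pattern_def)
  obtain a where a: "1 \<le> a" "a < length \<sigma>" "\<not> entry \<sigma> a < entry \<sigma> (length \<sigma>)"
    using \<sigma> by (auto simp: ends_below_max_def)
  let ?l = "length \<sigma>"
  have lt: "f a < f ?l" using f(1) a by (auto simp: strict_mono_on_def)
  have in1: "f b \<in> {1..Suc (length \<pi>)}" if "b \<in> {1..?l}" for b using f(2) that by blast
  have last: "f ?l \<le> length \<pi>"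
  proof (rule ccontr)
    assume "\<not> ?thesis"
    with in1[of ?l] a have eq: "f ?l = Suc (length \<pi>)" by auto
    have "f a \<ge> 1" "f a \<le> length \<pi>" using lt eq in1[of a] a by auto
    then have "entry (\<pi> @ [x]) (f a) \<in> set \<pi>"
      by (simp add: entry_append_left) (simp add: entry_def)
    with x eq o[of a ?l] a show False by (auto simp: entry_def)
  qed
  have range: "f b \<in> {1..length \<pi>}" if b: "b \<in> {1..?l}" for b
  proof -
    have "f b \<le> f ?l" using f(1) b by (cases "b = ?l") (auto simp: strict_mono_on_def intro: less_imp_le)
    with last in1[OF b] show ?thesis by auto
  qed
  have "entry (\<pi> @ [x]) (f b) = entry \<pi> (f b)" if "b \<in> {1..?l}" for b
    using range[OF that] by (auto intro: entry_append_left)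
  with f(1) range o show "contains_pattern \<pi> \<sigma>"
    unfolding contains_pattern_def by (intro exI[of _ f]) auto
next
  assume "contains_pattern \<pi> \<sigma>"
  then obtain f where f: "strict_mono_on {1..length \<sigma>} f" "f ` {1..length \<sigma>} \<subseteq> {1..length \<pi>}"
    and o: "\<And>a b. 1 \<le> a \<Longrightarrow> a < b \<Longrightarrow> b \<le> length \<sigma> \<Longrightarrow>
      (entry \<pi> (f a) < entry \<pi> (f b) \<longleftrightarrow> entry \<sigma> a < entry \<sigma> b)"
    by (auto simp: contains_pattern_def)
  have r: "f b \<in> {1..length \<pi>}" if "b \<in> {1..length \<sigma>}" for b using f(2) that by blast
  have "entry (\<pi> @ [x]) (f b) = entry \<pi> (f b)" if "b \<in> {1..length \<sigma>}" for b
    using r[OF that] by (auto intro: entry_append_left)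
  moreover have "f ` {1..length \<sigma>} \<subseteq> {1..length (\<pi> @ [x])}" using f(2) by fastforce
  ultimately show "contains_pattern (\<pi> @ [x]) \<sigma>"
    using f(1) o unfolding contains_pattern_def by (intro exI[of _ f]) auto
qed

section \<open>Permutation words\<close>

lemma avoiders_iff:
  "\<pi> \<in> avoiders n P \<longleftrightarrow>
     set \<pi> = {1..n} \<and> distinct \<pi> \<and> (\<forall>\<sigma>\<in>P. \<not> contains_pattern \<pi> \<sigma>)"
  by (auto simp: avoiders_def permutations_of_set_def)

lemma avoidersD:
  assumes "\<pi> \<in> avoiders n P"
  shows "set \<pi> = {1..n}" "distinct \<pi>" "length \<pi> = n"
    "\<sigma> \<in> P \<Longrightarrow> \<not> contains_pattern \<pi> \<sigma>"
proof -
  show *: "set \<pi> = {1..n}" "distinct \<pi>" "\<sigma> \<in> P \<Longrightarrow> \<not> contains_pattern \<pi> \<sigma>"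
    using assms unfolding avoiders_iff by blast+
  show "length \<pi> = n" using distinct_card[OF *(2)] *(1) by simp
qed

lemma finite_avoiders: "finite (avoiders n P)"
  by (rule finite_subset[of _ "permutations_of_set {1..n}"]) (auto simp: avoiders_def)

text \<open>
  An appended maximum takes part in no occurrence of these patterns, so the avoiders of length
  \<open>n + 1\<close> ending with their maximum are copies of all avoiders of length \<open>n\<close>. This is what makes the
  recursion on the length possible.
\<close>

lemma avoiders_snoc_max:
  assumes "\<forall>\<sigma>\<in>P. ends_below_max \<sigma>"
  shows "\<pi> @ [Suc n] \<in> avoiders (Suc n) P \<longleftrightarrow> \<pi> \<in> avoiders n P"
proof -
  have interval: "{1..Suc n} = insert (Suc n) {1..n}" "Suc n \<notin> {1..n}"
    by (simp_all add: atLeastAtMostSuc_conv)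
  have "set (\<pi> @ [Suc n]) = {1..Suc n} \<and> distinct (\<pi> @ [Suc n]) \<longleftrightarrow>
      insert (Suc n) (set \<pi>) = insert (Suc n) {1..n} \<and> Suc n \<notin> set \<pi> \<and> distinct \<pi>"
    unfolding interval(1) by auto
  also have "\<dots> \<longleftrightarrow> set \<pi> = {1..n} \<and> distinct \<pi>"
    using interval(2) by (metis insert_ident)
  finally have "set (\<pi> @ [Suc n]) = {1..Suc n} \<and> distinct (\<pi> @ [Suc n]) \<longleftrightarrow>
      set \<pi> = {1..n} \<and> distinct \<pi>" .
  moreover have "contains_pattern (\<pi> @ [Suc n]) \<sigma> \<longleftrightarrow> contains_pattern \<pi> \<sigma>"
    if "set \<pi> = {1..n}" "\<sigma> \<in> P" for \<sigma>
    using assms that by (intro contains_pattern_snoc_max) simp_all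
  ultimately show ?thesis unfolding avoiders_iff by blast
qed

section \<open>The statistics under appending a letter\<close>

lemma DES_subset: "DES \<pi> \<subseteq> {1..<length \<pi>}"
  by (auto simp: DES_def)

lemma finite_DES [simp]: "finite (DES \<pi>)"
  by (rule finite_subset[OF DES_subset]) simp

lemma DES_snoc:
  assumes "\<pi> \<noteq> []"
  shows "DES (\<pi> @ [x]) = DES \<pi> \<union> (if x < last \<pi> then {length \<pi>} else {})"
proof -
  have "i \<in> DES (\<pi> @ [x]) \<longleftrightarrow> i \<in> DES \<pi> \<or> i = length \<pi> \<and> x < last \<pi>" for i
  proof (cases "i = length \<pi>")
    case True
    moreover have "1 \<le> length \<pi>" using assms by (cases \<pi>) auto
    ultimately show ?thesis using assms
      by (auto simp: DES_def entry_def nth_append last_conv_nth)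
  next
    case False
    then show ?thesis by (auto simp: DES_def entry_def nth_append)
  qed
  then show ?thesis by auto
qed

lemma DES_map_Suc: "DES (map Suc \<pi>) = DES \<pi>"
  by (auto simp: DES_def entry_def)

lemma DES_empty_iff_sorted: "DES \<pi> = {} \<longleftrightarrow> sorted \<pi>"
proof -
  have "DES \<pi> = {} \<longleftrightarrow> (\<forall>i. Suc i < length \<pi> \<longrightarrow> \<pi> ! i \<le> \<pi> ! Suc i)"
  proof
    assume *: "DES \<pi> = {}"
    show "\<forall>i. Suc i < length \<pi> \<longrightarrow> \<pi> ! i \<le> \<pi> ! Suc i"
    proof (intro allI impI)
      fix i assume "Suc i < length \<pi>"
      moreover have "Suc i \<notin> DES \<pi>" using * by blast
      ultimately show "\<pi> ! i \<le> \<pi> ! Suc i" by (auto simp: DES_def entry_def)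
    qed
  next
    assume *: "\<forall>i. Suc i < length \<pi> \<longrightarrow> \<pi> ! i \<le> \<pi> ! Suc i"
    show "DES \<pi> = {}"
    proof (rule equals0I)
      fix i assume "i \<in> DES \<pi>"
      with *[rule_format, of "i - 1"] show False by (auto simp: DES_def entry_def)
    qed
  qed
  then show ?thesis by (simp add: sorted_iff_nth_Suc)
qed

lemma des_snoc_descent: "\<pi> \<noteq> [] \<Longrightarrow> x < last \<pi> \<Longrightarrow> des (\<pi> @ [x]) = Suc (des \<pi>)"
  using DES_subset[of \<pi>] by (auto simp: des_def DES_snoc card_insert_if)

text \<open>
  This needs no exception for increasing words: the new descent sits at position \<open>length \<pi>\<close>, which is
  the default value of \<^const>\<open>iar\<close> for a word without descents.
\<close>

lemma iar_snoc_descent: "\<pi> \<noteq> [] \<Longrightarrow> x < last \<pi> \<Longrightarrow> iar (\<pi> @ [x]) = iar \<pi>"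
proof -
  assume *: "\<pi> \<noteq> []" "x < last \<pi>"
  let ?A = "insert (length \<pi>) (DES \<pi>)"
  have "iar (\<pi> @ [x]) = Min (insert (Suc (length \<pi>)) ?A)"
    using * by (simp add: iar_def DES_snoc insert_commute)
  also have "\<dots> = min (Suc (length \<pi>)) (Min ?A)" by (rule Min_insert) auto
  also have "\<dots> = Min ?A"
  proof -
    have "Min ?A \<le> length \<pi>" by (rule Min_le) auto
    then show ?thesis by (intro min_absorb2) linarith
  qed
  finally show ?thesis by (simp add: iar_def)
qed

lemma
  assumes "\<pi> \<noteq> []" "last \<pi> < x"
  shows DES_snoc_ascent: "DES (\<pi> @ [x]) = DES \<pi>"
    and des_snoc_ascent: "des (\<pi> @ [x]) = des \<pi>"
    and iar_snoc_ascent: "DES \<pi> \<noteq> {} \<Longrightarrow> iar (\<pi> @ [x]) = iar \<pi>"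
proof -
  show *: "DES (\<pi> @ [x]) = DES \<pi>" using assms by (simp add: DES_snoc)
  then show "des (\<pi> @ [x]) = des \<pi>" by (simp add: des_def)
  assume ne: "DES \<pi> \<noteq> {}"
  have "Min (DES \<pi>) \<in> DES \<pi>" using ne by simp
  then have "Min (DES \<pi>) < length \<pi>" using DES_subset[of \<pi>] by auto
  with * ne show "iar (\<pi> @ [x]) = iar \<pi>" by (simp add: iar_def)
qed

lemma num_comp_snoc_max:
  assumes "set \<pi> = {1..n}" "length \<pi> = n"
  shows "num_comp (\<pi> @ [Suc n]) = Suc (num_comp \<pi>)"
proof -
  let ?C = "\<lambda>\<pi>. {i \<in> {1..length \<pi>}. \<forall>j\<in>{1..i}. entry \<pi> j \<le> i}"
  have le: "entry (\<pi> @ [Suc n]) j \<le> Suc n" if "j \<in> {1..Suc n}" for j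
  proof -
    have "entry (\<pi> @ [Suc n]) j \<in> set (\<pi> @ [Suc n])"
      unfolding entry_def using that assms by (intro nth_mem) auto
    with assms show ?thesis by auto
  qed
  have "?C (\<pi> @ [Suc n]) = insert (Suc n) (?C \<pi>)"
    using le assms(2) by (auto simp: le_Suc_eq entry_append_left)
  then show ?thesis using assms(2) by (simp add: num_comp_def card_insert_if)
qed

text \<open>
  A component boundary at \<open>i < n + 1\<close> means that the first \<open>i\<close> letters are exactly \<open>1, \<dots>, i\<close>. Then the
  last letter exceeds the first one, and the maximum, which comes neither first nor last, stands
  between them: a 132. So the only boundary is the one at the very end.
\<close>

lemma num_comp_132_avoider:
  assumes set: "set \<pi> = {1..Suc n}" and dist: "distinct \<pi>" and last: "last \<pi> \<noteq> Suc n"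
    and avoid: "\<not> contains_pattern \<pi> [1, 3, 2]"
  shows "num_comp \<pi> = 1"
proof -
  have len: "length \<pi> = Suc n" using distinct_card[OF dist] set by simp
  have mem: "entry \<pi> j \<in> {1..Suc n}" if "j \<in> {1..Suc n}" for j
    using that len nth_mem[of "j - 1" \<pi>] by (auto simp: entry_def set simp del: nth_mem)
  have False if i: "i \<in> {1..n}" "\<forall>j\<in>{1..i}. entry \<pi> j \<le> i" for i
  proof -
    have "set (take i \<pi>) \<subseteq> {1..i}"
    proof
      fix x assume "x \<in> set (take i \<pi>)"
      then obtain k where k: "k < i" "k < length \<pi>" "x = \<pi> ! k" by (auto simp: in_set_conv_nth)
      then show "x \<in> {1..i}" using i(2)[rule_format, of "Suc k"] mem[of "Suc k"] len by (auto simp: entry_def)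
    qed
    moreover have "card (set (take i \<pi>)) = i"
      using dist i len distinct_card[of "take i \<pi>"] by simp
    ultimately have pre: "set (take i \<pi>) = {1..i}"
      by (intro card_subset_eq) auto
    have big: "\<pi> ! k > i" if "k < Suc n" "k \<ge> i" for k
    proof -
      have "\<pi> ! k \<in> set (drop i \<pi>)"
        using that len by (auto simp: in_set_conv_nth intro!: exI[of _ "k - i"])
      moreover have "set (take i \<pi>) \<inter> set (drop i \<pi>) = {}"
        using dist by (rule set_take_disj_set_drop_if_distinct) simp
      moreover have "\<pi> ! k \<in> {1..Suc n}" using mem[of "Suc k"] that by (auto simp: entry_def)
      ultimately show ?thesis using pre by auto
    qed
    obtain q where q: "q < Suc n" "\<pi> ! q = Suc n"
    proof -
      have "Suc n \<in> set \<pi>" using set by simp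
      with len show ?thesis using that by (auto simp: in_set_conv_nth)
    qed
    have first: "\<pi> ! 0 \<le> i" using i(1) i(2)[rule_format, of 1] by (auto simp: entry_def)
    have lastn: "\<pi> ! n \<noteq> Suc n" using last len last_conv_nth[of \<pi>] by (cases \<pi>) auto
    have "\<pi> ! n < Suc n" using lastn mem[of "Suc n"] by (auto simp: entry_def)
    moreover have "q < n" using q lastn by (cases "q = n") auto
    moreover have "0 < q" using first q i by (cases "q = 0") auto
    moreover have "\<pi> ! 0 < \<pi> ! n" using big[of n] first i by auto
    moreover have "\<pi> ! 0 < \<pi> ! q" using first q i by auto
    ultimately have "contains_pattern \<pi> [1,3,2]"
      unfolding contains_pattern_3 using q len
      by (intro exI[of _ 0] exI[of _ q] exI[of _ n]) auto
    with avoid show False by simp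
  qed
  moreover have "entry \<pi> j \<le> Suc n" if "j \<in> {1..Suc n}" for j using mem[OF that] by simp
  ultimately have "{i \<in> {1..length \<pi>}. \<forall>j\<in>{1..i}. entry \<pi> j \<le> i} = {Suc n}"
    unfolding len by (auto simp: le_Suc_eq)
  then show ?thesis by (simp add: num_comp_def)
qed


section \<open>The identity and the remaining permutations\<close>

lemma identity_avoider:
  assumes "\<forall>\<sigma>\<in>P. ends_below_max \<sigma>"
  shows "[1..<Suc n] \<in> avoiders n P"
proof (induction n)
  case 0
  have "\<not> contains_pattern [] \<sigma>" if "ends_below_max \<sigma>" for \<sigma>
    using that by (force simp: contains_pattern_def ends_below_max_def)
  with assms show ?case by (auto simp: avoiders_iff)
next
  case (Suc n)
  with avoiders_snoc_max[OF assms, of "[1..<Suc n]" n] show ?case by simp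
qed

lemma no_descent_avoiders:
  assumes "\<forall>\<sigma>\<in>P. ends_below_max \<sigma>"
  shows "{\<pi> \<in> avoiders n P. DES \<pi> = {}} = {[1..<Suc n]}"
proof -
  have "\<pi> = [1..<Suc n]" if "\<pi> \<in> avoiders n P" "sorted \<pi>" for \<pi>
  proof (rule sorted_distinct_set_unique)
    show "set \<pi> = set [1..<Suc n]"
      unfolding avoidersD(1)[OF that(1)] set_upt by (rule atLeastLessThanSuc_atLeastAtMost[symmetric])
  qed (use that avoidersD(2)[OF that(1)] in \<open>simp_all del: upt_Suc\<close>)
  moreover have "sorted [1..<Suc n]" by (rule sorted_upt)
  ultimately show ?thesis
    using identity_avoider[OF assms, of n] unfolding DES_empty_iff_sorted by blast
qed

lemma num_comp_identity: "num_comp [1..<Suc n] = n"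
proof (induction n)
  case 0
  show ?case by (simp add: num_comp_def)
next
  case (Suc n)
  have "num_comp ([1..<Suc n] @ [Suc n]) = Suc (num_comp [1..<Suc n])"
    by (rule num_comp_snoc_max) (auto simp del: upt_Suc)
  with Suc show ?case by simp
qed

text \<open>
  The increasing word is the only one without a descent. It is set apart because \<^const>\<open>iar\<close> behaves
  differently on it: appending a new maximum raises \<^const>\<open>iar\<close> there, but nowhere else.
\<close>

definition descending_avoiders :: "nat \<Rightarrow> nat list set \<Rightarrow> nat list set" where
  "descending_avoiders n P = {\<pi> \<in> avoiders n P. DES \<pi> \<noteq> {}}"

text \<open>
  The index is shifted: these words have length \<open>n + 1\<close>, because in passing from length \<open>n\<close> to
  length \<open>n + 1\<close> they are added to the words that arise by appending a maximum.
\<close>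

definition low_ended_avoiders :: "nat \<Rightarrow> nat list set \<Rightarrow> nat list set" where
  "low_ended_avoiders n P = {\<pi> \<in> avoiders (Suc n) P. last \<pi> \<noteq> Suc n}"

lemma finite_descending_avoiders: "finite (descending_avoiders n P)"
  by (simp add: descending_avoiders_def finite_avoiders)

lemma descending_avoiders_0: "descending_avoiders 0 P = {}"
  using avoidersD(3)[of _ 0 P] by (fastforce simp: descending_avoiders_def DES_def)

lemma descending_avoidersD:
  assumes "\<pi> \<in> descending_avoiders n P"
  shows "\<pi> \<in> avoiders n P" "DES \<pi> \<noteq> {}" "\<pi> \<noteq> []" "last \<pi> < Suc n"
proof -
  show *: "\<pi> \<in> avoiders n P" "DES \<pi> \<noteq> {}" using assms by (auto simp: descending_avoiders_def)
  show ne: "\<pi> \<noteq> []" using *(2) by (force simp: DES_def)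
  have "last \<pi> \<in> {1..n}" using last_in_set[OF ne] unfolding avoidersD(1)[OF *(1)] .
  then show "last \<pi> < Suc n" by simp
qed

lemma descending_avoiders_Suc:
  assumes P: "\<forall>\<sigma>\<in>P. ends_below_max \<sigma>"
  shows "descending_avoiders (Suc n) P =
    (\<lambda>\<pi>. \<pi> @ [Suc n]) ` descending_avoiders n P \<union> low_ended_avoiders n P"
proof (intro equalityI subsetI)
  fix \<pi> assume \<pi>: "\<pi> \<in> descending_avoiders (Suc n) P"
  show "\<pi> \<in> (\<lambda>\<pi>. \<pi> @ [Suc n]) ` descending_avoiders n P \<union> low_ended_avoiders n P"
  proof (cases "last \<pi> = Suc n")
    case False
    with \<pi> show ?thesis by (auto simp: descending_avoiders_def low_ended_avoiders_def)
  next
    case True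
    define \<rho> where "\<rho> = butlast \<pi>"
    have eq: "\<pi> = \<rho> @ [Suc n]"
      using True descending_avoidersD(3)[OF \<pi>] append_butlast_last_id[of \<pi>] by (simp add: \<rho>_def)
    have \<rho>: "\<rho> \<in> avoiders n P"
      using descending_avoidersD(1)[OF \<pi>] avoiders_snoc_max[OF P] by (simp add: eq)
    have "\<rho> \<noteq> []" using descending_avoidersD(2)[OF \<pi>] by (auto simp: eq DES_def)
    moreover from this have "last \<rho> < Suc n"
      using avoidersD(1)[OF \<rho>] last_in_set[of \<rho>] by auto
    ultimately have "DES \<pi> = DES \<rho>" by (simp add: eq DES_snoc_ascent)
    with \<rho> descending_avoidersD(2)[OF \<pi>] have "\<rho> \<in> descending_avoiders n P"
      by (simp add: descending_avoiders_def)
    with eq show ?thesis by blast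
  qed
next
  fix \<pi> assume "\<pi> \<in> (\<lambda>\<pi>. \<pi> @ [Suc n]) ` descending_avoiders n P \<union> low_ended_avoiders n P"
  then show "\<pi> \<in> descending_avoiders (Suc n) P"
  proof
    assume "\<pi> \<in> (\<lambda>\<pi>. \<pi> @ [Suc n]) ` descending_avoiders n P"
    then obtain \<rho> where "\<rho> \<in> descending_avoiders n P" "\<pi> = \<rho> @ [Suc n]" by blast
    with descending_avoidersD[OF this(1)] show ?thesis
      by (simp add: descending_avoiders_def DES_snoc_ascent avoiders_snoc_max[OF P])
  next
    assume "\<pi> \<in> low_ended_avoiders n P"
    then have \<pi>: "\<pi> \<in> avoiders (Suc n) P" "last \<pi> \<noteq> Suc n" by (auto simp: low_ended_avoiders_def)
    have "Suc n \<in> set \<pi>" using avoidersD(1)[OF \<pi>(1)] by simp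
    moreover from this have split: "\<pi> = butlast \<pi> @ [last \<pi>]" by (cases \<pi>) auto
    moreover have "set \<pi> = insert (last \<pi>) (set (butlast \<pi>))" by (subst split) simp
    ultimately have "Suc n \<in> set (butlast \<pi>)" using \<pi>(2) by auto
    moreover have "last \<pi> < Suc n"
    proof -
      have "last \<pi> \<in> {1..Suc n}"
        using last_in_set[of \<pi>] split unfolding avoidersD(1)[OF \<pi>(1)] by blast
      with \<pi>(2) show ?thesis by auto
    qed
    ultimately have "\<not> sorted (butlast \<pi> @ [last \<pi>])" unfolding sorted_append by force
    with split have "\<not> sorted \<pi>" by simp
    with \<pi>(1) show ?thesis by (simp add: descending_avoiders_def DES_empty_iff_sorted)
  qed
qed

section \<open>The generating functions of the pieces\<close>

definition descending_gf :: "nat list set \<Rightarrow> 'a \<Rightarrow> 'a \<Rightarrow> 'a \<Rightarrow> 'a::comm_ring_1 fps" where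
  "descending_gf P t r p =
     Abs_fps (\<lambda>n. \<Sum>\<pi>\<in>descending_avoiders n P. t ^ des \<pi> * r ^ iar \<pi> * p ^ num_comp \<pi>)"

definition low_ended_gf :: "nat list set \<Rightarrow> 'a \<Rightarrow> 'a \<Rightarrow> 'a::comm_ring_1 fps" where
  "low_ended_gf P t r = Abs_fps (\<lambda>n. \<Sum>\<pi>\<in>low_ended_avoiders n P. t ^ des \<pi> * r ^ iar \<pi>)"

lemma geometric_fps:
  fixes c :: "'a::comm_ring_1"
  shows "Abs_fps (\<lambda>n. c ^ n) * (1 - fps_const c * fps_X) = 1"
proof (rule fps_ext)
  fix n
  have "Abs_fps (\<lambda>n. c ^ n) * (1 - fps_const c * fps_X) =
      Abs_fps (\<lambda>n. c ^ n) - fps_const c * (fps_X * Abs_fps (\<lambda>n. c ^ n))"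
    by (simp add: algebra_simps)
  then show "(Abs_fps (\<lambda>n. c ^ n) * (1 - fps_const c * fps_X)) $ n = 1 $ n"
    by (cases n) simp_all
qed

lemma des_iar_comp_gf_split:
  assumes "\<forall>\<sigma>\<in>P. ends_below_max \<sigma>"
  shows "des_iar_comp_gf P t r p = Abs_fps (\<lambda>n. (r * p) ^ n) + descending_gf P t r p"
proof (rule fps_ext)
  fix n
  let ?w = "\<lambda>\<pi>. t ^ des \<pi> * r ^ iar \<pi> * p ^ num_comp \<pi>"
  have id: "[1..<Suc n] \<notin> descending_avoiders n P" "DES [1..<Suc n] = {}"
    by (auto simp: descending_avoiders_def DES_empty_iff_sorted simp del: upt_Suc)
  have "avoiders n P = insert [1..<Suc n] (descending_avoiders n P)"
    using no_descent_avoiders[OF assms, of n] by (auto simp: descending_avoiders_def)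
  then have "sum ?w (avoiders n P) = ?w [1..<Suc n] + sum ?w (descending_avoiders n P)"
    using id(1) by (simp add: finite_descending_avoiders del: upt_Suc)
  also have "?w [1..<Suc n] = (r * p) ^ n"
    using id(2) num_comp_identity[of n]
    by (simp add: des_def iar_def power_mult_distrib del: upt_Suc)
  finally show "des_iar_comp_gf P t r p $ n =
      (Abs_fps (\<lambda>n. (r * p) ^ n) + descending_gf P t r p) $ n"
    by (simp add: des_iar_comp_gf_def descending_gf_def)
qed

text \<open>
  An appended maximum keeps \<^const>\<open>des\<close> and \<^const>\<open>iar\<close> and adds one component. A low-ended avoider has
  a single component because it avoids 132. Both contributions thus carry exactly one more factor
  \<open>p\<close>, and the variable \<open>p\<close> no longer occurs in the generating function of the low-ended avoiders.
\<close>

lemma descending_gf_eq: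
  assumes P: "\<forall>\<sigma>\<in>P. ends_below_max \<sigma>" and "[1, 3, 2] \<in> P"
  shows "descending_gf P t r p = fps_const p * fps_X * (descending_gf P t r p + low_ended_gf P t r)"
proof (rule fps_ext)
  fix n
  let ?w = "\<lambda>\<pi>. t ^ des \<pi> * r ^ iar \<pi> * p ^ num_comp \<pi>"
  let ?v = "\<lambda>\<pi>. t ^ des \<pi> * r ^ iar \<pi>"
  let ?rhs = "fps_const p * (fps_X * (descending_gf P t r p + low_ended_gf P t r))"
  have "descending_gf P t r p $ n = ?rhs $ n"
  proof (cases n)
    case 0
    then show ?thesis by (simp add: descending_gf_def descending_avoiders_0)
  next
    case (Suc m)
    let ?f = "\<lambda>\<pi>. \<pi> @ [Suc m]"
    have "sum ?w (descending_avoiders n P) =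
        sum ?w (?f ` descending_avoiders m P) + sum ?w (low_ended_avoiders m P)"
      unfolding Suc descending_avoiders_Suc[OF P]
      by (rule sum.union_disjoint)
         (auto simp: low_ended_avoiders_def finite_avoiders finite_descending_avoiders)
    also have "sum ?w (?f ` descending_avoiders m P) = (\<Sum>\<pi>\<in>descending_avoiders m P. ?w (?f \<pi>))"
      by (subst sum.reindex) (auto simp: inj_on_def)
    also have "\<dots> = (\<Sum>\<pi>\<in>descending_avoiders m P. p * ?w \<pi>)"
    proof (rule sum.cong[OF refl])
      fix \<pi> assume "\<pi> \<in> descending_avoiders m P"
      note d = descending_avoidersD[OF this]
      show "?w (?f \<pi>) = p * ?w \<pi>"
        using d avoidersD[OF d(1)]
        by (simp add: des_snoc_ascent iar_snoc_ascent num_comp_snoc_max)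
    qed
    also have "sum ?w (low_ended_avoiders m P) = (\<Sum>\<pi>\<in>low_ended_avoiders m P. p * ?v \<pi>)"
    proof (rule sum.cong[OF refl])
      fix \<pi> assume "\<pi> \<in> low_ended_avoiders m P"
      then have l: "\<pi> \<in> avoiders (Suc m) P" "last \<pi> \<noteq> Suc m" by (auto simp: low_ended_avoiders_def)
      have "num_comp \<pi> = 1"
        using avoidersD[OF l(1)] l(2) assms(2) by (intro num_comp_132_avoider) auto
      then show "?w \<pi> = p * ?v \<pi>" by simp
    qed
    finally show ?thesis
      by (simp add: Suc descending_gf_def low_ended_gf_def sum_distrib_left distrib_left)
  qed
  then show "descending_gf P t r p $ n =
      (fps_const p * fps_X * (descending_gf P t r p + low_ended_gf P t r)) $ n"
    by (simp add: mult.assoc)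
qed

text \<open>
  Solving for the descending part gives \<open>D = p z L / (1 - p z)\<close>. The factor \<open>r\<close> that the hypothesis on
  \<open>L\<close> splits off reflects that \<^const>\<open>iar\<close> is positive; with \<open>p z\<close> it makes up the divisor \<open>r p z\<close>.
  The hypothesis is stated without division so that it can be checked in any commutative ring.
\<close>

lemma des_iar_comp_gf_tilde_eq:
  fixes r p :: "'a::field"
  assumes P: "\<forall>\<sigma>\<in>P. ends_below_max \<sigma>" "[1, 3, 2] \<in> P" and "r \<noteq> 0" "p \<noteq> 0"
    and M: "low_ended_gf P t r * (1 - fps_const r * fps_X) * Q = fps_const r * N" and Q: "Q $ 0 \<noteq> 0"
  shows "des_iar_comp_gf_tilde P t r p = 1 / (1 - fps_const r * fps_const p * fps_X) +
    N / ((1 - fps_const r * fps_X) * (1 - fps_const p * fps_X) * Q)"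
proof -
  define R where "R = fps_const r"
  define C where "C = fps_const p"
  define X where "X = (fps_X :: 'a fps)"
  define A where "A = Abs_fps (\<lambda>n. (r * p) ^ n)"
  define D where "D = descending_gf P t r p"
  define L where "L = low_ended_gf P t r"
  define d where "d = (1 - R * X) * (1 - C * X) * Q"
  define B where "B = 1 / (1 - R * C * X)"
  define E where "E = N / d"
  note defs = R_def C_def X_def A_def D_def L_def
  have A: "A * (1 - R * C * X) = 1"
    using geometric_fps[of "r * p"] by (simp add: defs flip: fps_const_mult)
  have D: "D = C * X * (D + L)" using descending_gf_eq[OF P] unfolding defs by blast
  have L: "L * (1 - R * X) * Q = R * N" using M by (simp add: defs)
  have unit: "f \<noteq> 0" "g / f * f = g" if "f $ 0 \<noteq> 0" for f g :: "'a fps"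
    using that by (force, simp add: fps_divide_unit mult.assoc inverse_mult_eq_1)
  have "d $ 0 \<noteq> 0" using Q by (simp add: d_def defs)
  then have E: "E * d = N" and d0: "d \<noteq> 0" unfolding E_def by (rule unit(2), rule unit(1))
  have "(1 - R * C * X) $ 0 \<noteq> 0" by (simp add: defs)
  then have B: "B * (1 - R * C * X) = 1" and c0: "1 - R * C * X \<noteq> 0"
    unfolding B_def by (rule unit(2), rule unit(1))
  \<comment> \<open>Power series over a field form an integral domain, so the denominators can be cancelled.\<close>
  have "A = B" using A B c0 mult_right_cancel[of "1 - R * C * X" A B] by simp
  then have AB: "A - 1 = R * C * X * B" using B by (simp add: algebra_simps)
  have "D * (1 - C * X) = C * X * L" using D by (simp add: algebra_simps)
  then have "D * d = C * X * (L * (1 - R * X) * Q)" by (simp add: d_def mult_ac)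
  then have "D * d = R * C * X * E * d" using L E by (simp add: mult_ac)
  then have DE: "D = R * C * X * E" using d0 by simp
  have "des_iar_comp_gf P t r p - 1 = (R * C * X) * (B + E)"
    using AB DE des_iar_comp_gf_split[OF P(1), of t r p] by (simp add: defs algebra_simps)
  moreover have "fps_const (r * p) * fps_X = R * C * X" by (simp add: defs)
  moreover have "R * C * X \<noteq> 0" using assms(3,4) by (simp add: defs)
  ultimately have "des_iar_comp_gf_tilde P t r p = B + E"
    unfolding des_iar_comp_gf_tilde_def by simp
  then show ?thesis by (simp add: B_def E_def d_def defs)
qed

section \<open>The patterns 132 and 312\<close>

text \<open>
  In both 132 and 312 the last letter takes the middle value, and the two patterns together allow
  either order of the other two. The indices \<open>i\<close> and \<open>j\<close> are therefore not ordered here.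
\<close>

definition never_between :: "nat list \<Rightarrow> bool" where
  "never_between \<pi> \<longleftrightarrow>
     (\<forall>i j k. i < k \<longrightarrow> j < k \<longrightarrow> k < length \<pi> \<longrightarrow> \<not> (\<pi> ! i < \<pi> ! k \<and> \<pi> ! k < \<pi> ! j))"

lemma avoids_132_312_iff:
  assumes "distinct \<pi>"
  shows "\<not> contains_pattern \<pi> [1, 3, 2] \<and> \<not> contains_pattern \<pi> [3, 1, 2] \<longleftrightarrow> never_between \<pi>"
proof -
  have neq: "\<pi> ! i < \<pi> ! j \<longleftrightarrow> \<not> \<pi> ! j < \<pi> ! i" if "i < j" "j < length \<pi>" for i j
    using nth_eq_iff_index_eq[OF assms, of i j] that by linarith
  have "contains_pattern \<pi> [1, 3, 2] \<longleftrightarrow>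
      (\<exists>i j k. i < j \<and> j < k \<and> k < length \<pi> \<and> \<pi> ! i < \<pi> ! k \<and> \<pi> ! k < \<pi> ! j)"
  proof -
    have "i < j \<and> j < k \<and> k < length \<pi> \<and> (\<pi> ! i < \<pi> ! j \<longleftrightarrow> (1::nat) < 3) \<and>
        (\<pi> ! i < \<pi> ! k \<longleftrightarrow> (1::nat) < 2) \<and> (\<pi> ! j < \<pi> ! k \<longleftrightarrow> (3::nat) < 2) \<longleftrightarrow>
        i < j \<and> j < k \<and> k < length \<pi> \<and> \<pi> ! i < \<pi> ! k \<and> \<pi> ! k < \<pi> ! j" for i j k
      using neq[of j k] by auto
    then show ?thesis unfolding contains_pattern_3 by presburger
  qed
  moreover have "contains_pattern \<pi> [3, 1, 2] \<longleftrightarrow>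
      (\<exists>i j k. i < j \<and> j < k \<and> k < length \<pi> \<and> \<pi> ! j < \<pi> ! k \<and> \<pi> ! k < \<pi> ! i)"
  proof -
    have "i < j \<and> j < k \<and> k < length \<pi> \<and> (\<pi> ! i < \<pi> ! j \<longleftrightarrow> (3::nat) < 1) \<and>
        (\<pi> ! i < \<pi> ! k \<longleftrightarrow> (3::nat) < 2) \<and> (\<pi> ! j < \<pi> ! k \<longleftrightarrow> (1::nat) < 2) \<longleftrightarrow>
        i < j \<and> j < k \<and> k < length \<pi> \<and> \<pi> ! j < \<pi> ! k \<and> \<pi> ! k < \<pi> ! i" for i j k
      using neq[of i k] neq[of i j] by auto
    then show ?thesis unfolding contains_pattern_3 by presburger
  qed
  moreover have "never_between \<pi> \<longleftrightarrow>
      \<not> (\<exists>i j k. i < j \<and> j < k \<and> k < length \<pi> \<and> \<pi> ! i < \<pi> ! k \<and> \<pi> ! k < \<pi> ! j) \<and>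
      \<not> (\<exists>i j k. i < j \<and> j < k \<and> k < length \<pi> \<and> \<pi> ! j < \<pi> ! k \<and> \<pi> ! k < \<pi> ! i)"
    (is "_ \<longleftrightarrow> \<not> ?C1 \<and> \<not> ?C2")
  proof
    assume "never_between \<pi>"
    then show "\<not> ?C1 \<and> \<not> ?C2" unfolding never_between_def by (meson less_trans)
  next
    assume C: "\<not> ?C1 \<and> \<not> ?C2"
    show "never_between \<pi>"
      unfolding never_between_def
    proof (intro allI impI notI)
      fix i j k assume "i < k" "j < k" "k < length \<pi>" "\<pi> ! i < \<pi> ! k \<and> \<pi> ! k < \<pi> ! j"
      then show False using C by (cases i j rule: linorder_cases) (blast, simp, blast)
    qed
  qed
  ultimately show ?thesis by simp
qed

lemma avoiders_132_312_iff:
  "\<pi> \<in> avoiders n {[1, 3, 2], [3, 1, 2]} \<longleftrightarrow> set \<pi> = {1..n} \<and> distinct \<pi> \<and> never_between \<pi>"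
  unfolding avoiders_iff using avoids_132_312_iff by blast

lemma never_between_snoc:
  "never_between (\<pi> @ [x]) \<longleftrightarrow> never_between \<pi> \<and> \<not> (\<exists>a\<in>set \<pi>. \<exists>b\<in>set \<pi>. a < x \<and> x < b)"
proof -
  have "never_between (\<pi> @ [x]) \<longleftrightarrow> never_between \<pi> \<and>
      (\<forall>i<length \<pi>. \<forall>j<length \<pi>. \<not> (\<pi> ! i < x \<and> x < \<pi> ! j))"
    by (auto simp: never_between_def nth_append less_Suc_eq)
  also have "(\<forall>i<length \<pi>. \<forall>j<length \<pi>. \<not> (\<pi> ! i < x \<and> x < \<pi> ! j)) \<longleftrightarrow>
      (\<forall>a\<in>set \<pi>. \<forall>b\<in>set \<pi>. \<not> (a < x \<and> x < b))"
    unfolding all_set_conv_all_nth by (rule refl)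
  finally show ?thesis by blast
qed

lemma never_between_map_Suc: "never_between (map Suc \<pi>) \<longleftrightarrow> never_between \<pi>"
  by (auto simp: never_between_def)

lemma low_ended_avoiders_0: "low_ended_avoiders 0 P = {}"
proof -
  have "last \<pi> = 1" if "\<pi> \<in> avoiders 1 P" for \<pi>
    using avoidersD(1,3)[OF that] by (cases \<pi>) auto
  then show ?thesis by (auto simp: low_ended_avoiders_def)
qed

text \<open>
  The last letter does not lie strictly between two earlier letters, so it is \<open>n + 1\<close> or \<open>1\<close>. For
  \<open>n = 0\<close> these two coincide, hence the restriction on \<open>n\<close>.
\<close>

lemma low_ended_132_312:
  assumes "0 < n"
  shows "low_ended_avoiders n {[1, 3, 2], [3, 1, 2]} =
    (\<lambda>\<pi>. map Suc \<pi> @ [1]) ` avoiders n {[1, 3, 2], [3, 1, 2]}" (is "?L = ?f ` ?A")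
proof (intro equalityI subsetI)
  fix \<pi> assume "\<pi> \<in> ?f ` ?A"
  then obtain \<tau> where "\<tau> \<in> ?A" "\<pi> = map Suc \<tau> @ [1]" by blast
  then have \<tau>: "set \<tau> = {1..n}" "distinct \<tau>" "never_between \<tau>" "\<pi> = map Suc \<tau> @ [1]"
    unfolding avoiders_132_312_iff by blast+
  have "set \<pi> = insert 1 (Suc ` {1..n})" by (simp add: \<tau>)
  also have "\<dots> = {1..Suc n}" by (simp add: image_Suc_atLeastAtMost) auto
  finally have "set \<pi> = {1..Suc n}" .
  moreover have "distinct \<pi>" using \<tau>(1,2) by (auto simp: \<tau>(4) distinct_map)
  moreover have "never_between \<pi>"
    using \<tau>(3) by (simp add: \<tau>(4) never_between_snoc never_between_map_Suc)
  moreover have "last \<pi> \<noteq> Suc n" using assms by (simp add: \<tau>(4))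
  ultimately show "\<pi> \<in> ?L"
    unfolding low_ended_avoiders_def avoiders_132_312_iff by blast
next
  fix \<pi> assume "\<pi> \<in> ?L"
  then have \<pi>: "set \<pi> = {1..Suc n}" "distinct \<pi>" "never_between \<pi>" "last \<pi> \<noteq> Suc n"
    unfolding low_ended_avoiders_def avoiders_132_312_iff by blast+
  have "\<pi> \<noteq> []" using \<pi>(1) by auto
  then obtain \<rho> x where eq: "\<pi> = \<rho> @ [x]" by (cases \<pi> rule: rev_cases) auto
  have x: "x \<in> {1..Suc n}" "x \<noteq> Suc n" using \<pi>(1,4) by (auto simp: eq)
  have \<rho>: "set \<rho> = {1..Suc n} - {x}" using \<pi>(1,2) by (auto simp: eq)
  have "x = 1"
  proof (rule ccontr)
    assume "x \<noteq> 1"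
    with x have "1 \<in> set \<rho>" "Suc n \<in> set \<rho>" "1 < x" "x < Suc n" unfolding \<rho> by auto
    with \<pi>(3) show False unfolding eq never_between_snoc by blast
  qed
  define \<tau> where "\<tau> = map (\<lambda>y. y - 1) \<rho>"
  have "map Suc \<tau> = map id \<rho>"
    unfolding \<tau>_def map_map using \<rho> \<open>x = 1\<close> by (intro map_cong) auto
  then have \<tau>: "map Suc \<tau> = \<rho>" by simp
  have "Suc ` set \<tau> = Suc ` {1..n}"
  proof -
    have "Suc ` set \<tau> = set \<rho>" by (simp flip: \<tau>)
    also have "\<dots> = {2..Suc n}" unfolding \<rho> \<open>x = 1\<close> by auto
    finally show ?thesis by (simp add: image_Suc_atLeastAtMost numeral_2_eq_2)
  qed
  then have "set \<tau> = {1..n}" unfolding inj_image_eq_iff[OF inj_Suc] .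
  moreover have "distinct (map Suc \<tau>)" using \<pi>(2) unfolding \<tau> eq by simp
  then have "distinct \<tau>" by (simp add: distinct_map)
  moreover have "never_between \<tau>"
    using \<pi>(3) never_between_map_Suc[of \<tau>] by (simp add: eq never_between_snoc \<tau>)
  ultimately have "\<tau> \<in> ?A" unfolding avoiders_132_312_iff by blast
  with \<tau> eq \<open>x = 1\<close> show "\<pi> \<in> ?f ` ?A" by blast
qed

lemma stats_drop_to_new_minimum:
  assumes "0 < n" "set \<pi> = {1..n}"
  shows "des (map Suc \<pi> @ [1]) = Suc (des \<pi>)" "iar (map Suc \<pi> @ [1]) = iar \<pi>"
proof -
  have ne: "\<pi> \<noteq> []" using assms by auto
  then have "last \<pi> \<ge> 1" using assms last_in_set[of \<pi>] by auto
  with ne have *: "1 < last (map Suc \<pi>)" by (simp add: last_map)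
  show "des (map Suc \<pi> @ [1]) = Suc (des \<pi>)"
    using ne * des_snoc_descent[of "map Suc \<pi>" 1] by (simp add: des_def DES_map_Suc)
  show "iar (map Suc \<pi> @ [1]) = iar \<pi>"
    using ne * iar_snoc_descent[of "map Suc \<pi>" 1] by (simp add: iar_def DES_map_Suc)
qed

lemma low_ended_gf_132_312_eq:
  "low_ended_gf {[1, 3, 2], [3, 1, 2]} t r =
     fps_const t * (des_iar_comp_gf {[1, 3, 2], [3, 1, 2]} t r 1 - 1)"
proof (rule fps_ext)
  fix n
  let ?P = "{[1, 3, 2], [3, 1, 2]} :: nat list set"
  show "low_ended_gf ?P t r $ n = (fps_const t * (des_iar_comp_gf ?P t r 1 - 1)) $ n"
  proof (cases "n = 0")
    case True
    \<comment> \<open>The summand \<open>- 1\<close> removes the empty word: a letter appended to it creates no descent.\<close>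
    have "avoiders 0 ?P = {[]}" unfolding set_eq_iff avoiders_132_312_iff by (auto simp: never_between_def)
    then show ?thesis
      by (simp add: True low_ended_gf_def des_iar_comp_gf_def low_ended_avoiders_0)
         (simp add: des_def iar_def DES_def)
  next
    case False
    let ?f = "\<lambda>\<pi>. map Suc \<pi> @ [1]"
    have "(\<Sum>\<pi>\<in>low_ended_avoiders n ?P. t ^ des \<pi> * r ^ iar \<pi>) =
        (\<Sum>\<pi>\<in>avoiders n ?P. t ^ des (?f \<pi>) * r ^ iar (?f \<pi>))"
      using False by (subst low_ended_132_312) (auto simp: sum.reindex inj_on_def inj_map_eq_map)
    also have "\<dots> = (\<Sum>\<pi>\<in>avoiders n ?P. t * (t ^ des \<pi> * r ^ iar \<pi>))"
    proof (rule sum.cong[OF refl])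
      fix \<pi> assume "\<pi> \<in> avoiders n ?P"
      from stats_drop_to_new_minimum[OF _ avoidersD(1)[OF this]] False
      show "t ^ des (?f \<pi>) * r ^ iar (?f \<pi>) = t * (t ^ des \<pi> * r ^ iar \<pi>)"
        by (simp add: mult.assoc)
    qed
    finally show ?thesis
      using False by (simp add: low_ended_gf_def des_iar_comp_gf_def sum_distrib_left)
  qed
qed

text \<open>
  Put \<open>A = 1 / (1 - r z)\<close>. With \<open>p = 1\<close> the two equations \<open>D = z (D + L)\<close> and \<open>L = t (A + D - 1)\<close> form a
  linear system, and eliminating \<open>D\<close> gives \<open>(1 - z - t z) L = t (1 - z) (A - 1)\<close>.
\<close>

lemma low_ended_gf_132_312:
  fixes t r :: "'a::comm_ring_1"
  shows "low_ended_gf {[1, 3, 2], [3, 1, 2]} t r * (1 - fps_const r * fps_X) *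
      (1 - fps_X - fps_const t * fps_X) =
    fps_const r * ((1 - fps_X) * fps_const t * fps_X)"
proof -
  let ?P = "{[1, 3, 2], [3, 1, 2]} :: nat list set"
  define T where "T = fps_const t"
  define R where "R = fps_const r"
  define X where "X = (fps_X :: 'a fps)"
  define A where "A = Abs_fps (\<lambda>n. r ^ n)"
  define D where "D = descending_gf ?P t r 1"
  define L where "L = low_ended_gf ?P t r"
  note defs = T_def R_def X_def A_def D_def L_def
  have P: "\<forall>\<sigma>\<in>?P. ends_below_max \<sigma>" "[1, 3, 2] \<in> ?P" using ends_below_max_patterns by auto
  have A: "A * (1 - R * X) = 1" using geometric_fps[of r] by (simp add: defs)
  have D: "D = X * (D + L)" using descending_gf_eq[OF P, of t r 1] by (simp add: defs)
  have L: "L = T * (A + D - 1)"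
    using low_ended_gf_132_312_eq[of t r] des_iar_comp_gf_split[OF P(1), of t r 1] by (simp add: defs)
  have D': "D * (1 - X) = X * L" using D by (simp add: algebra_simps)
  have "L * (1 - X) = T * ((A - 1) * (1 - X) + D * (1 - X))"
    by (subst L) (simp add: algebra_simps)
  then have "L * (1 - X - T * X) = T * (1 - X) * (A - 1)"
    unfolding D' by (simp add: algebra_simps)
  then have "L * (1 - X - T * X) * (1 - R * X) = T * (1 - X) * (A - 1) * (1 - R * X)"
    by (rule arg_cong)
  also have "\<dots> = T * (1 - X) * (A * (1 - R * X) - (1 - R * X))"
    by (simp add: algebra_simps)
  finally have "L * (1 - R * X) * (1 - X - T * X) = T * (1 - X) * (R * X)"
    unfolding A by (simp add: mult_ac)
  then show ?thesis by (simp add: defs mult_ac)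
qed

section \<open>The patterns 132 and 321\<close>

definition two_runs :: "nat \<Rightarrow> nat \<Rightarrow> nat list" where
  "two_runs n m = [Suc m..<Suc (Suc n)] @ [1..<Suc m]"

lemma length_two_runs: "m \<le> n \<Longrightarrow> length (two_runs n m) = Suc n"
  by (simp add: two_runs_def del: upt_Suc)

lemma nth_two_runs:
  "m \<le> n \<Longrightarrow> i \<le> n \<Longrightarrow>
     two_runs n m ! i = (if i < Suc n - m then Suc (m + i) else Suc (i - (Suc n - m)))"
  by (auto simp: two_runs_def nth_append simp del: upt_Suc)

lemma two_runs_avoider:
  assumes m: "m \<le> n"
  shows "two_runs n m \<in> avoiders (Suc n) {[1, 3, 2], [3, 2, 1]}"
proof -
  have "set (two_runs n m) = {1..Suc n}"
    using m by (auto simp: two_runs_def simp del: upt_Suc)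
  moreover have "distinct (two_runs n m)"
    by (auto simp: two_runs_def simp del: upt_Suc)
  moreover have "\<not> contains_pattern (two_runs n m) [1, 3, 2]"
  proof
    assume "contains_pattern (two_runs n m) [1, 3, 2]"
    then obtain i j k where "i < j" "j < k" "k < Suc n"
      "two_runs n m ! i < two_runs n m ! k" "\<not> two_runs n m ! j < two_runs n m ! k"
      unfolding contains_pattern_3 using m by (auto simp: length_two_runs)
    then show False using m by (auto simp: nth_two_runs split: if_splits)
  qed
  moreover have "\<not> contains_pattern (two_runs n m) [3, 2, 1]"
  proof
    assume "contains_pattern (two_runs n m) [3, 2, 1]"
    then obtain i j k where "i < j" "j < k" "k < Suc n"
      "\<not> two_runs n m ! i < two_runs n m ! j" "\<not> two_runs n m ! j < two_runs n m ! k"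
      unfolding contains_pattern_3 using m by (auto simp: length_two_runs)
    then show False using m by (auto simp: nth_two_runs split: if_splits)
  qed
  ultimately show ?thesis unfolding avoiders_iff by simp
qed

text \<open>
  Let \<open>q\<close> be the position of the maximum, which is not the last one. A letter before \<open>q\<close> exceeds every
  letter after \<open>q\<close>, since otherwise the maximum completes a 132. The letters before \<open>q\<close> increase,
  since a descent there and the last letter form a 321; the letters after \<open>q\<close> increase, since the
  maximum and a descent there form a 321. Moving the part after \<open>q\<close> to the front therefore sorts
  the word.
\<close>

lemma low_ended_132_321:
  "low_ended_avoiders n {[1, 3, 2], [3, 2, 1]} = two_runs n ` {1..n}" (is "?L = _")
proof (intro equalityI subsetI)
  fix \<pi> assume "\<pi> \<in> two_runs n ` {1..n}"
  then obtain m where m: "1 \<le> m" "m \<le> n" "\<pi> = two_runs n m" by auto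
  have "last \<pi> = m" using m by (cases m) (auto simp: two_runs_def)
  with m two_runs_avoider[of m n] show "\<pi> \<in> ?L" by (simp add: low_ended_avoiders_def)
next
  fix \<pi> assume "\<pi> \<in> ?L"
  then have \<pi>: "\<pi> \<in> avoiders (Suc n) {[1, 3, 2], [3, 2, 1]}" "last \<pi> \<noteq> Suc n"
    by (simp_all add: low_ended_avoiders_def)
  note len = avoidersD(3)[OF \<pi>(1)]
  have av: "\<not> contains_pattern \<pi> [1, 3, 2]" "\<not> contains_pattern \<pi> [3, 2, 1]"
    using avoidersD(4)[OF \<pi>(1)] by simp_all
  have neq: "\<pi> ! i \<noteq> \<pi> ! j" if "i < j" "j \<le> n" for i j
    using nth_eq_iff_index_eq[OF avoidersD(2)[OF \<pi>(1)], of i j] that len by simp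
  have no132: False if "i < j" "j < k" "k \<le> n" "\<pi> ! i < \<pi> ! k" "\<pi> ! k < \<pi> ! j" for i j k
  proof -
    have "contains_pattern \<pi> [1, 3, 2]"
      unfolding contains_pattern_3 using that len
      by (intro exI[of _ i] exI[of _ j] exI[of _ k]) auto
    with av show False by simp
  qed
  have no321: False if "i < j" "j < k" "k \<le> n" "\<pi> ! j < \<pi> ! i" "\<pi> ! k < \<pi> ! j" for i j k
  proof -
    have "contains_pattern \<pi> [3, 2, 1]"
      unfolding contains_pattern_3 using that len
      by (intro exI[of _ i] exI[of _ j] exI[of _ k]) auto
    with av show False by simp
  qed
  have "Suc n \<in> set \<pi>" unfolding avoidersD(1)[OF \<pi>(1)] by simp
  then obtain q where q: "q \<le> n" "\<pi> ! q = Suc n" using len by (metis in_set_conv_nth less_Suc_eq_le)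
  have "\<pi> ! n \<noteq> Suc n" using \<pi>(2) len last_conv_nth[of \<pi>] by (cases \<pi>) auto
  with q have "q < n" by (cases "q = n") auto
  have below: "\<pi> ! i < Suc n" if "i \<le> n" "i \<noteq> q" for i
  proof -
    have "\<pi> ! i \<in> {1..Suc n}" unfolding avoidersD(1)[OF \<pi>(1), symmetric] using that len by simp
    moreover have "\<pi> ! i \<noteq> Suc n" using neq[of i q] neq[of q i] that q by (cases "i < q") auto
    ultimately show ?thesis by simp
  qed
  have cross: "\<pi> ! k < \<pi> ! i" if "i < q" "q < k" "k \<le> n" for i k
    using no132[of i q k] below[of k] neq[of i k] that q by (cases "\<pi> ! k < \<pi> ! i") auto
  have left: "\<pi> ! i < \<pi> ! j" if "i < j" "j \<le> q" for i j
  proof (cases "j = q")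
    case True
    then show ?thesis using below[of i] that q by simp
  next
    case False
    then show ?thesis
      using no321[of i j n] cross[of j n] neq[of i j] that \<open>q < n\<close> by (cases "\<pi> ! i < \<pi> ! j") auto
  qed
  have right: "\<pi> ! i < \<pi> ! j" if "q < i" "i < j" "j \<le> n" for i j
    using no321[of q i j] below[of i] neq[of i j] that q by (cases "\<pi> ! i < \<pi> ! j") auto
  define A where "A = take (Suc q) \<pi>"
  define B where "B = drop (Suc q) \<pi>"
  have split: "\<pi> = A @ B" by (simp add: A_def B_def)
  have "sorted A" unfolding A_def sorted_iff_nth_mono_less using left len by (auto intro: less_imp_le)
  moreover have "sorted B" unfolding B_def sorted_iff_nth_mono_less using right len
    by (auto intro!: less_imp_le)
  moreover have "b \<le> a" if ab: "a \<in> set A" "b \<in> set B" for a b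
  proof -
    obtain i where "i < Suc q" "a = \<pi> ! i"
      using ab(1) \<open>q < n\<close> len by (auto simp: A_def in_set_conv_nth)
    then have i: "i \<le> q" "a = \<pi> ! i" by simp_all
    obtain k where "k < length B" "b = B ! k" using ab(2) by (auto simp: in_set_conv_nth)
    then obtain k where k: "q < k" "k \<le> n" "b = \<pi> ! k"
      using len by (intro that[of "Suc q + k"]) (auto simp: B_def)
    show ?thesis
    proof (cases "i = q")
      case True
      then show ?thesis using below[of k] k i q by simp
    next
      case False
      then show ?thesis using cross[of i k] i k by simp
    qed
  qed
  ultimately have "sorted (B @ A)" by (auto simp: sorted_append)
  moreover have "distinct (B @ A)" "set (B @ A) = {1..Suc n}"
    using avoidersD(1,2)[OF \<pi>(1)] unfolding split by auto
  ultimately have BA: "B @ A = [1..<Suc (Suc n)]"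
    by (intro sorted_distinct_set_unique)
       (simp_all only: sorted_upt distinct_upt set_upt atLeastLessThanSuc_atLeastAtMost)
  define m where "m = length B"
  have m: "1 \<le> m" "m \<le> n" using \<open>q < n\<close> len by (auto simp: m_def B_def)
  have "B = take m (B @ A)" "A = drop m (B @ A)" by (simp_all add: m_def)
  with m have "B = [1..<Suc m]" "A = [Suc m..<Suc (Suc n)]"
    unfolding BA by (simp_all add: take_upt drop_upt del: upt_Suc)
  then have "\<pi> = two_runs n m" by (simp only: split two_runs_def)
  with m show "\<pi> \<in> two_runs n ` {1..n}" by auto
qed

lemma DES_two_runs:
  assumes "1 \<le> m" "m \<le> n"
  shows "DES (two_runs n m) = {Suc n - m}"
proof -
  have "i \<in> DES (two_runs n m) \<longleftrightarrow> i = Suc n - m" for i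
  proof (cases "1 \<le> i \<and> i \<le> n")
    case True
    then show ?thesis
      using assms by (auto simp: DES_def entry_def length_two_runs nth_two_runs)
  next
    case False
    then show ?thesis using assms by (auto simp: DES_def length_two_runs)
  qed
  then show ?thesis by auto
qed

text \<open>
  The word with \<open>m\<close> letters in its second run contributes \<open>t r\<^sup>j\<close> with \<open>j = n + 1 - m\<close>, its unique
  descent position.
\<close>

lemma low_ended_gf_132_321_eq:
  "low_ended_gf {[1, 3, 2], [3, 2, 1]} t r = fps_const t * Abs_fps (\<lambda>n. \<Sum>j=1..n. r ^ j)"
proof (rule fps_ext)
  fix n
  let ?P = "{[1, 3, 2], [3, 2, 1]} :: nat list set"
  have stats: "des (two_runs n m) = 1" "iar (two_runs n m) = Suc n - m" if "m \<in> {1..n}" for m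
    using that by (auto simp: des_def iar_def DES_two_runs length_two_runs)
  have "inj_on (two_runs n) {1..n}"
  proof (rule inj_onI)
    fix l m assume lm: "l \<in> {1..n}" "m \<in> {1..n}" "two_runs n l = two_runs n m"
    have "Suc n - l = Suc n - m" using stats(2)[OF lm(1)] stats(2)[OF lm(2)] lm(3) by metis
    then show "l = m" using lm(1,2) by auto
  qed
  then have "(\<Sum>\<pi>\<in>low_ended_avoiders n ?P. t ^ des \<pi> * r ^ iar \<pi>) =
      (\<Sum>m=1..n. t ^ des (two_runs n m) * r ^ iar (two_runs n m))"
    unfolding low_ended_132_321 by (simp add: sum.reindex)
  also have "\<dots> = (\<Sum>m=1..n. t * r ^ (Suc n - m))"
    by (rule sum.cong) (auto simp: stats)
  also have "\<dots> = (\<Sum>j=1..n. t * r ^ j)"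
    by (rule sum.reindex_bij_witness[of _ "\<lambda>j. Suc n - j" "\<lambda>m. Suc n - m"]) auto
  finally show "low_ended_gf ?P t r $ n = (fps_const t * Abs_fps (\<lambda>n. \<Sum>j=1..n. r ^ j)) $ n"
    by (simp add: low_ended_gf_def sum_distrib_left)
qed

lemma low_ended_gf_132_321:
  fixes t r :: "'a::comm_ring_1"
  shows "low_ended_gf {[1, 3, 2], [3, 2, 1]} t r * (1 - fps_const r * fps_X) * (1 - fps_X) =
    fps_const r * (fps_const t * fps_X)"
proof -
  let ?S = "Abs_fps (\<lambda>n. \<Sum>j=1..n. r ^ j)"
  let ?A = "Abs_fps (\<lambda>n. r ^ n)"
  have "(?S - fps_X * ?S) $ n = (?A - 1) $ n" for n by (cases n) simp_all
  then have "?S * (1 - fps_X) = ?A - 1" by (intro fps_ext) (simp add: algebra_simps)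
  then have "?S * (1 - fps_X) * (1 - fps_const r * fps_X) = fps_const r * fps_X"
    using geometric_fps[of r] by (simp add: left_diff_distrib)
  then have "fps_const t * (?S * (1 - fps_X) * (1 - fps_const r * fps_X)) =
      fps_const t * (fps_const r * fps_X)" by (rule arg_cong)
  then show ?thesis unfolding low_ended_gf_132_321_eq by (simp only: mult_ac)
qed

section \<open>The two closed forms\<close>

theorem theorem4p2:
  defines "t \<equiv> fps_const var_t" and "r \<equiv> fps_const var_r" and "p \<equiv> fps_const var_p"
    and "z \<equiv> (fps_X :: coeff_field fps)"
  shows "des_iar_comp_gf_tilde {[1, 3, 2], [3, 1, 2]} var_t var_r var_p =
           1 / (1 - r * p * z) +
           ((1 - z) * t * z) / ((1 - r * z) * (1 - p * z) * (1 - z - t * z)) \<and>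
         des_iar_comp_gf_tilde {[1, 3, 2], [3, 2, 1]} var_t var_r var_p =
           1 / (1 - r * p * z) +
           (t * z) / ((1 - r * z) * (1 - p * z) * (1 - z))"
proof -
  have "var_r \<noteq> 0" "var_p \<noteq> 0" by (simp_all add: var_r_def var_p_def)
  note tilde = des_iar_comp_gf_tilde_eq[OF _ _ this]
  show ?thesis
    unfolding t_def r_def p_def z_def using ends_below_max_patterns
    by (intro conjI tilde low_ended_gf_132_312 low_ended_gf_132_321) simp_all
qed

end
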